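(* Let $d\ge1$ be an integer and let $V:\mathbb{T}^d\to\mathbb{R}$ be smooth with finite $C^2$-norm. Then there are at least $d+1$ different solutions $q=(q^1,\dots,q^d):\mathbb{T}^3\to\mathbb{T}^d$ to the system $$-\Delta q^\alpha=\partial_{q^\alpha}V(q),\qquad \alpha=1,\dots,d.$$
   Context: Here $\mathbb{T}=\mathbb{R}/\mathbb{Z}$, $\mathbb{T}^3$ has coordinates $t=(t_1,t_2,t_3)$, and $\Delta=\sum_{j=1}^3\partial^2/\partial t_j^2$ is the flat Laplacian, applied to the components of the torus-valued map $q$ (well defined because derivatives of a $\mathbb{T}^d$-valued map are $\mathbb{R}^d$-valued). Solutions are smooth maps. *)

theory Defs
  imports "HOL-Analysis.Analysis"
begin

section \<open>The flat torus\<close>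

definition integer_translates :: "real ^ 'n \<Rightarrow> real ^ 'n \<Rightarrow> bool" where
  "integer_translates x y \<longleftrightarrow> (\<forall>i. (x - y) $ i \<in> \<int>)"

lemma equivp_integer_translates: "equivp integer_translates"
proof (rule equivpI)
  show "reflp integer_translates"
    by (auto simp: reflp_def integer_translates_def)
  show "symp integer_translates"
  proof (rule sympI)
    fix x y :: "real ^ 'n" assume "integer_translates x y"
    then have "- (x $ i - y $ i) \<in> \<int>" for i
      unfolding integer_translates_def by (intro Ints_minus) simp
    then show "integer_translates y x" by (simp add: integer_translates_def)
  qed
  show "transp integer_translates"
  proof (rule transpI)
    fix x y z :: "real ^ 'n" assume "integer_translates x y" "integer_translates y z"
    then have "(x $ i - y $ i) + (y $ i - z $ i) \<in> \<int>" for i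
      unfolding integer_translates_def by (intro Ints_add) simp_all
    then show "integer_translates x z" by (simp add: integer_translates_def)
  qed
qed

text \<open>The dimension of the torus is \<open>CARD('n)\<close>.\<close>

quotient_type 'n torus = "real ^ ('n::finite)" / integer_translates
  morphisms rep_torus torus_proj
  by (rule equivp_integer_translates)

lemma torus_proj_eq_iff:
  "torus_proj x = torus_proj y \<longleftrightarrow> (\<forall>i. (x - y) $ i \<in> \<int>)"
  by (simp add: torus.abs_eq_iff integer_translates_def)

lift_definition torus_shift :: "'n::finite torus \<Rightarrow> real ^ 'n \<Rightarrow> 'n torus" is "\<lambda>x v. x + v"
  by (simp add: integer_translates_def)


section \<open>Smoothness\<close>

text \<open>Meaningful for open sets \<open>S\<close> only.\<close>

fun Ck_on :: "nat \<Rightarrow> 'a::euclidean_space set \<Rightarrow> ('a \<Rightarrow> 'b::real_normed_vector) \<Rightarrow> bool" where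
  "Ck_on 0 S f \<longleftrightarrow> continuous_on S f"
| "Ck_on (Suc k) S f \<longleftrightarrow>
     (\<forall>x\<in>S. f differentiable (at x)) \<and>
     (\<forall>b\<in>Basis. Ck_on k S (\<lambda>x. frechet_derivative f (at x) b))"

definition smooth_on :: "'a::euclidean_space set \<Rightarrow> ('a \<Rightarrow> 'b::real_normed_vector) \<Rightarrow> bool" where
  "smooth_on S f \<longleftrightarrow> (\<forall>k. Ck_on k S f)"

text \<open>
  The local inverses of the covering \<^const>\<open>torus_proj\<close> are the charts of the torus. Hence a
  vector-valued function is smooth iff its pullback to \<open>real ^ 'n\<close> is, and a torus-valued map
  is smooth iff it locally has a smooth lift.
\<close>

definition torus_smooth :: "('n::finite torus \<Rightarrow> 'b::real_normed_vector) \<Rightarrow> bool" where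
  "torus_smooth F \<longleftrightarrow> smooth_on UNIV (\<lambda>x. F (torus_proj x))"

definition torus_smooth_map :: "('n::finite torus \<Rightarrow> 'm::finite torus) \<Rightarrow> bool" where
  "torus_smooth_map q \<longleftrightarrow>
     (\<forall>x. \<exists>U Q. open U \<and> x \<in> U \<and> smooth_on U Q \<and>
        (\<forall>y\<in>U. q (torus_proj y) = torus_proj (Q y)))"


section \<open>Derivatives\<close>

definition torus_pderiv ::
  "'n::finite \<Rightarrow> ('n torus \<Rightarrow> 'b::real_normed_vector) \<Rightarrow> 'n torus \<Rightarrow> 'b" where
  "torus_pderiv j F p = vector_derivative (\<lambda>s. F (torus_shift p (s *\<^sub>R axis j 1))) (at 0)"

text \<open>The derivative of a curve in the torus, a vector in \<open>real ^ 'm\<close>, is that of any local lift.\<close>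

definition has_torus_derivative ::
  "(real \<Rightarrow> 'm::finite torus) \<Rightarrow> real ^ 'm \<Rightarrow> real \<Rightarrow> bool" where
  "has_torus_derivative c v s \<longleftrightarrow>
     (\<exists>\<gamma>. (\<forall>\<^sub>F r in nhds s. c r = torus_proj (\<gamma> r)) \<and> (\<gamma> has_vector_derivative v) (at s))"

lemma has_torus_derivative_unique:
  assumes "has_torus_derivative c v s" and "has_torus_derivative c w s"
  shows "v = w"
proof -
  obtain f where f: "\<forall>\<^sub>F r in nhds s. c r = torus_proj (f r)" "(f has_vector_derivative v) (at s)"
    using assms(1) unfolding has_torus_derivative_def by blast
  obtain g where g: "\<forall>\<^sub>F r in nhds s. c r = torus_proj (g r)" "(g has_vector_derivative w) (at s)"
    using assms(2) unfolding has_torus_derivative_def by blast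
  define h where "h r = f r - g r" for r
  have h: "(h has_vector_derivative (v - w)) (at s)"
    unfolding h_def by (intro has_vector_derivative_diff f g)
  have ev: "\<forall>\<^sub>F r in nhds s. torus_proj (f r) = torus_proj (g r)"
    using f(1) g(1) by eventually_elim simp
  then have int: "\<forall>\<^sub>F r in nhds s. \<forall>i. h r $ i \<in> \<int>"
    by (simp add: torus_proj_eq_iff h_def)
  have "isCont h s"
    using h has_vector_derivative_continuous by blast
  then have "\<forall>\<^sub>F r in at s. dist (h r) (h s) < 1"
    unfolding isCont_def tendsto_iff by simp
  then have "\<forall>\<^sub>F r in nhds s. dist (h r) (h s) < 1"
    by (simp add: eventually_nhds_conv_at)
  then have const: "\<forall>\<^sub>F r in nhds s. h r = h s"
    using int
  proof eventually_elim
    case (elim r)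
    have s_int: "h s $ i \<in> \<int>" for i
      using eventually_nhds_x_imp_x[OF int] by blast
    have "h r $ i = h s $ i" for i
    proof -
      have "\<bar>(h r - h s) $ i\<bar> < 1"
        using component_le_norm_cart[of "h r - h s" i] elim(1) by (simp add: dist_norm)
      then have "\<bar>h r $ i - h s $ i\<bar> < 1" by simp
      moreover have "h r $ i - h s $ i \<in> \<int>" using elim(2) s_int by simp
      ultimately have "h r $ i - h s $ i = 0" using Ints_nonzero_abs_less1 by blast
      then show ?thesis by simp
    qed
    then show ?case by (simp add: vec_eq_iff)
  qed
  have "((\<lambda>_. h s) has_vector_derivative (v - w)) (at s)"
    using h const
    by (subst has_vector_derivative_cong_ev[where g = h and S = UNIV]) (auto elim: eventually_mono)
  then have "v - w = 0"
    using has_vector_derivative_const vector_derivative_unique_at by blast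
  then show ?thesis by simp
qed

definition torus_map_pderiv ::
  "'n::finite \<Rightarrow> ('n torus \<Rightarrow> 'm::finite torus) \<Rightarrow> 'n torus \<Rightarrow> real ^ 'm" where
  "torus_map_pderiv j q p =
     (THE v. has_torus_derivative (\<lambda>s. q (torus_shift p (s *\<^sub>R axis j 1))) v 0)"

definition torus_map_laplacian ::
  "('n::finite torus \<Rightarrow> 'm::finite torus) \<Rightarrow> 'n torus \<Rightarrow> real ^ 'm" where
  "torus_map_laplacian q p = (\<Sum>j\<in>UNIV. torus_pderiv j (torus_map_pderiv j q) p)"

definition C2_norm :: "('n::finite torus \<Rightarrow> real) \<Rightarrow> ennreal" where
  "C2_norm V =
     (SUP p. ennreal \<bar>V p\<bar>) +
     (\<Sum>i\<in>UNIV. SUP p. ennreal \<bar>torus_pderiv i V p\<bar>) +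
     (\<Sum>i\<in>UNIV. \<Sum>j\<in>UNIV. SUP p. ennreal \<bar>torus_pderiv i (torus_pderiv j V) p\<bar>)"

definition laplace_solution :: "('m::finite torus \<Rightarrow> real) \<Rightarrow> (3 torus \<Rightarrow> 'm torus) \<Rightarrow> bool" where
  "laplace_solution V q \<longleftrightarrow>
     torus_smooth_map q \<and>
     (\<forall>t \<alpha>. - (torus_map_laplacian q t $ \<alpha>) = torus_pderiv \<alpha> V (q t))"

end

theory Submission
  imports Defs
begin

text \<open>
  The solutions found here depend on a single coordinate and wind around the target torus. Write
  \<open>U\<close> for the lift of \<open>V\<close> to \<open>real ^ 'd\<close> and let \<open>e\<close> be a unit coordinate vector. If \<open>\<kappa> \<ge> 1\<close> is an
  integer and a curve \<open>\<phi>\<close> in \<open>real ^ 'd\<close> satisfies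
    \<open>\<phi>'' = - \<kappa>\<^sup>-\<^sup>2 \<nabla>U(\<phi>)\<close>  and  \<open>\<phi> (s + 1) = \<phi> s + e\<close>,
  then \<open>t \<mapsto> \<phi> (\<kappa> t\<^sub>1)\<close> descends to a map of tori that solves the system and has winding number \<open>\<kappa>\<close>
  in the direction \<open>e\<close> (\<open>winding_orbit_gives_solution\<close>). Different \<open>\<kappa>\<close> give different maps
  (\<open>winds_unique\<close>), so it suffices to find such a curve for all large \<open>\<kappa>\<close>. For large \<open>\<kappa>\<close> the force
  is weak: its Lipschitz constant is of order \<open>\<kappa>\<^sup>-\<^sup>2\<close>, by the bound on the second derivatives of \<open>V\<close>.

  Absorb the factor \<open>\<kappa>\<^sup>-\<^sup>2\<close> into \<open>U\<close> and put \<open>g = \<nabla>U\<close>. The curve comes from a Lyapunov-Schmidt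
  reduction. Write \<open>\<phi> s = a + s e + u s\<close> with \<open>u\<close> of period 1 and mean zero. The equation splits into
  \<open>u'' = - (g(\<phi>) - mean of g(\<phi>))\<close> and the finite-dimensional condition \<open>mean of g(\<phi>) = 0\<close>. For every
  \<open>a\<close> the first part is a fixed-point equation for a contraction; its solution \<open>u\<^sub>a\<close> depends on \<open>a\<close> in
  a Lipschitz way. The second part is variational. Let \<open>W a\<close> be the action of the resulting curve
  \<open>\<phi>\<^sub>a\<close>. Because the force is weak, Wirtinger's inequality makes the action convex on the affine space
  of all curves with the same \<open>a\<close>, so \<open>\<phi>\<^sub>a\<close> minimises the action there. Hence \<open>W (a + h)\<close> is at most
  the action of the translate \<open>\<phi>\<^sub>a + h\<close> (\<open>reduced_action_le\<close>). The continuous function \<open>W\<close> attains its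
  minimum, since translation by integer vectors does not change the action. At a minimum \<open>a\<close> the mean
  potential energy of \<open>\<phi>\<^sub>a + h\<close> is stationary at \<open>h = 0\<close>, which says that the mean of \<open>g(\<phi>\<^sub>a)\<close>
  vanishes (\<open>mean_force_zero_if_reduced_action_minimal\<close>).
\<close>

section \<open>Periodic functions and their mean-zero primitives\<close>

definition periodic :: "(real \<Rightarrow> 'a) \<Rightarrow> bool" where
  "periodic f \<longleftrightarrow> (\<forall>s. f (s + 1) = f s)"

lemma periodic_frac:
  assumes "periodic f"
  shows "f (frac s) = f s"
proof -
  have nat: "f (s + real n) = f s" for s n
  proof (induction n)
    case (Suc n)
    have "f (s + real n + 1) = f (s + real n)"
      using assms by (simp add: periodic_def)
    then show ?case using Suc by (simp add: add_ac)
  qed simp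
  show ?thesis
  proof (cases "\<lfloor>s\<rfloor> \<ge> 0")
    case True
    then show ?thesis using nat[of "frac s" "nat \<lfloor>s\<rfloor>"] by (simp add: frac_def)
  next
    case False
    then show ?thesis using nat[of s "nat (- \<lfloor>s\<rfloor>)"] by (simp add: frac_def)
  qed
qed

lemma periodic_continuous_imp_bcontfun:
  fixes f :: "real \<Rightarrow> 'a::real_normed_vector"
  assumes "periodic f" "continuous_on UNIV f"
  shows "f \<in> bcontfun"
proof -
  have "range f \<subseteq> f ` {0..1}"
  proof
    fix y assume "y \<in> range f"
    then obtain s where "y = f s" by blast
    then have "y = f (frac s)" using periodic_frac[OF assms(1)] by simp
    moreover have "frac s \<in> {0..1}" using frac_lt_1[of s] by simp
    ultimately show "y \<in> f ` {0..1}" by blast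
  qed
  moreover have "bounded (f ` {0..1})"
    using assms(2) by (intro compact_imp_bounded compact_continuous_image)
      (auto intro: continuous_on_subset)
  ultimately show ?thesis
    using assms(2) bounded_subset by (auto simp: bcontfun_def)
qed

text \<open>Since \<open>w\<close> has mean zero, \<open>w s\<close> is the average over \<open>r\<close> of the increments \<open>w s - w r\<close>.\<close>

lemma mean_zero_norm_le_integral_derivative:
  fixes w :: "real \<Rightarrow> 'a::euclidean_space"
  assumes w: "\<And>s. (w has_vector_derivative w' s) (at s)"
    and cont: "continuous_on UNIV w'"
    and per: "periodic w" and mean: "integral {0..1} w = 0"
  shows "norm (w s) \<le> integral {0..1} (\<lambda>r. norm (w' r))"
proof -
  define c where "c = integral {0..1} (\<lambda>r. norm (w' r))"
  have cw: "continuous_on T w" for T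
    using w by (intro continuous_at_imp_continuous_on) (auto intro: has_vector_derivative_continuous)
  have cw': "continuous_on T w'" for T
    using cont continuous_on_subset by blast
  have incr: "norm (w y - w x) \<le> c" if "0 \<le> x" "x \<le> y" "y \<le> 1" for x y
  proof -
    have "(w' has_integral (w y - w x)) {x..y}"
      using that w by (intro fundamental_theorem_of_calculus)
        (auto intro: has_vector_derivative_at_within)
    then have "w y - w x = integral {x..y} w'" by (simp add: integral_unique)
    also have "norm \<dots> \<le> integral {x..y} (\<lambda>r. norm (w' r))"
      by (intro integral_norm_bound_integral integrable_continuous_real continuous_intros cw') auto
    also have "\<dots> \<le> c"
      unfolding c_def using that
      by (intro integral_subset_le integrable_continuous_real continuous_intros cw') auto
    finally show ?thesis .
  qed
  have incr': "norm (w y - w x) \<le> c" if "x \<in> {0..1}" "y \<in> {0..1}" for x y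
    using incr[of x y] incr[of y x] that by (cases "x \<le> y") (auto simp: norm_minus_commute)
  have "norm (w r) \<le> c" if "r \<in> {0..1}" for r
  proof -
    have "integral {0..1} (\<lambda>x. w r - w x) = w r"
      using mean by (subst integral_diff) (auto intro!: integrable_continuous_real cw)
    moreover have "norm (integral {0..1} (\<lambda>x. w r - w x)) \<le> integral {0..1} (\<lambda>x::real. c)"
      using that by (intro integral_norm_bound_integral integrable_continuous_real
          continuous_intros cw incr') auto
    ultimately show ?thesis by simp
  qed
  then have "norm (w (frac s)) \<le> c"
    using frac_lt_1[of s] by simp
  then show ?thesis by (simp add: periodic_frac[OF per] c_def)
qed

lemma mean_zero_norm_le_derivative_bound:
  fixes w :: "real \<Rightarrow> 'a::euclidean_space"
  assumes "\<And>s. (w has_vector_derivative w' s) (at s)"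
    and cont: "continuous_on UNIV w'"
    and "periodic w" and "integral {0..1} w = 0"
    and B: "\<And>s. norm (w' s) \<le> B"
  shows "norm (w s) \<le> B"
proof -
  have "integral {0..1} (\<lambda>r. norm (w' r)) \<le> integral {0..1} (\<lambda>r::real. B)"
    using B by (intro integral_le integrable_continuous_real continuous_intros
        continuous_on_subset[OF cont]) auto
  then show ?thesis
    using mean_zero_norm_le_integral_derivative[OF assms(1-4), of s] by simp
qed

text \<open>The pointwise bound \<open>norm (w s) \<le> c\<close>, with \<open>c\<close> the mean of \<open>norm w'\<close>, reduces the claim to
  \<open>c\<^sup>2 \<le> mean of (norm w')\<^sup>2\<close>, which is the nonnegativity of a variance.\<close>

lemma wirtinger_inequality:
  fixes w :: "real \<Rightarrow> 'a::euclidean_space"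
  assumes w: "\<And>s. (w has_vector_derivative w' s) (at s)"
    and cont: "continuous_on UNIV w'"
    and "periodic w" and "integral {0..1} w = 0"
  shows "integral {0..1} (\<lambda>s. (norm (w s))\<^sup>2) \<le> integral {0..1} (\<lambda>s. (norm (w' s))\<^sup>2)"
proof -
  define c where "c = integral {0..1} (\<lambda>r. norm (w' r))"
  have cw: "continuous_on T w" for T
    using w by (intro continuous_at_imp_continuous_on) (auto intro: has_vector_derivative_continuous)
  have cw': "continuous_on T w'" for T
    using cont continuous_on_subset by blast
  have "norm (w s) \<le> c" for s
    unfolding c_def by (rule mean_zero_norm_le_integral_derivative[OF assms])
  then have "integral {0..1} (\<lambda>s. (norm (w s))\<^sup>2) \<le> integral {0..1} (\<lambda>s::real. c\<^sup>2)"
    by (intro integral_le integrable_continuous_real continuous_intros cw power_mono) auto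
  then have 1: "integral {0..1} (\<lambda>s. (norm (w s))\<^sup>2) \<le> c\<^sup>2" by simp
  have "0 \<le> integral {0..1} (\<lambda>s. (norm (w' s) - c)\<^sup>2)"
    by (intro integral_nonneg integrable_continuous_real continuous_intros cw') auto
  also have "\<dots> = integral {0..1} (\<lambda>s. (norm (w' s))\<^sup>2 - 2 * c * norm (w' s) + c\<^sup>2)"
    by (simp add: power2_diff algebra_simps)
  also have "\<dots> = integral {0..1} (\<lambda>s. (norm (w' s))\<^sup>2) - 2 * c * c + c\<^sup>2"
    unfolding c_def
    by (subst integral_add integral_diff integral_mult_right,
        (intro integrable_continuous_real continuous_intros cw')+)+ simp
  finally show ?thesis using 1 by (simp add: power2_eq_square)
qed

lemma integral_derivative_periodic:
  fixes f :: "real \<Rightarrow> 'b::banach"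
  assumes "\<And>s. (f has_vector_derivative f' s) (at s)" and "periodic f"
  shows "(f' has_integral 0) {0..1}"
proof -
  have "(f' has_integral (f 1 - f 0)) {0..1}"
    using assms(1) by (intro fundamental_theorem_of_calculus) (auto intro: has_vector_derivative_at_within)
  moreover have "f 1 = f 0" using assms(2) unfolding periodic_def by (metis add_0)
  ultimately show ?thesis by simp
qed

text \<open>Subtracting the mean of \<open>f\<close> makes a primitive periodic; the remaining constant of integration
  is fixed by the mean of the primitive.\<close>

lemma periodic_primitive_exists:
  fixes f :: "real \<Rightarrow> 'a::euclidean_space"
  assumes "periodic f" "continuous_on UNIV f"
  shows "\<exists>F. (\<forall>s. (F has_vector_derivative (f s - integral {0..1} f)) (at s)) \<and>
             periodic F \<and> integral {0..1} F = 0"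
proof -
  define h where "h s = f s - integral {0..1} f" for s
  have ch: "continuous_on T h" for T
    unfolding h_def using assms(2) by (intro continuous_intros) (auto intro: continuous_on_subset)
  have "isCont h x" for x
    using ch[of UNIV] by (simp add: continuous_on_eq_continuous_at)
  then obtain F where F: "\<And>s. (F has_vector_derivative h s) (at s)"
    using einterval_antiderivative[of "-\<infinity>" "\<infinity>" h] by auto
  have "(h has_integral (F 1 - F 0)) {0..1}"
    using F by (intro fundamental_theorem_of_calculus) (auto intro: has_vector_derivative_at_within)
  then have "F 1 - F 0 = integral {0..1} h" by (simp add: integral_unique)
  also have "\<dots> = 0"
    unfolding h_def using assms(2)
    by (subst integral_diff) (auto intro!: integrable_continuous_real intro: continuous_on_subset)
  finally have F01: "F 1 = F 0" by simp
  have shift: "((\<lambda>s. F (s + 1)) has_vector_derivative h s) (at s)" for s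
  proof -
    have "((F \<circ> (\<lambda>s. s + 1)) has_vector_derivative 1 *\<^sub>R h (s + 1)) (at s)"
      by (rule vector_diff_chain_at) (auto intro!: derivative_eq_intros F)
    moreover have "h (s + 1) = h s" using assms(1) by (simp add: h_def periodic_def)
    ultimately show ?thesis by (simp add: o_def)
  qed
  have "\<exists>c. \<forall>s\<in>UNIV. F (s + 1) - F s = c"
  proof (rule has_vector_derivative_zero_constant)
    fix s :: real
    have "((\<lambda>s. F (s + 1) - F s) has_vector_derivative (h s - h s)) (at s)"
      by (intro has_vector_derivative_diff shift F)
    then show "((\<lambda>s. F (s + 1) - F s) has_vector_derivative 0) (at s within UNIV)" by simp
  qed (auto)
  then obtain c where c: "\<And>s. F (s + 1) - F s = c" by auto
  have perF: "F (s + 1) = F s" for s using c[of s] c[of 0] F01 by simp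
  have cF: "continuous_on T F" for T
    using F by (intro continuous_at_imp_continuous_on) (auto intro: has_vector_derivative_continuous)
  define G where "G s = F s - integral {0..1} F" for s
  have "integral {0..1} G = 0"
    unfolding G_def by (subst integral_diff) (auto intro!: integrable_continuous_real cF)
  moreover have "periodic G" by (simp add: periodic_def G_def perF)
  moreover have "(G has_vector_derivative (f s - integral {0..1} f)) (at s)" for s
    unfolding G_def using F[of s] by (auto intro!: derivative_eq_intros simp: h_def)
  ultimately show ?thesis by blast
qed

definition mean_zero_primitive :: "(real \<Rightarrow> 'a::euclidean_space) \<Rightarrow> real \<Rightarrow> 'a" where
  "mean_zero_primitive f = (SOME F.
     (\<forall>s. (F has_vector_derivative (f s - integral {0..1} f)) (at s)) \<and>
     periodic F \<and> integral {0..1} F = 0)"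

lemma
  fixes f :: "real \<Rightarrow> 'a::euclidean_space"
  assumes "periodic f" "continuous_on UNIV f"
  shows mean_zero_primitive_derivative:
      "(mean_zero_primitive f has_vector_derivative (f s - integral {0..1} f)) (at s)"
    and periodic_mean_zero_primitive: "periodic (mean_zero_primitive f)"
    and mean_mean_zero_primitive: "integral {0..1} (mean_zero_primitive f) = 0"
    and continuous_mean_zero_primitive: "continuous_on UNIV (mean_zero_primitive f)"
proof -
  note ex = someI_ex[OF periodic_primitive_exists[OF assms], folded mean_zero_primitive_def]
  show der: "(mean_zero_primitive f has_vector_derivative (f s - integral {0..1} f)) (at s)" for s
    using ex by blast
  show "periodic (mean_zero_primitive f)" "integral {0..1} (mean_zero_primitive f) = 0"
    using ex by blast+
  show "continuous_on UNIV (mean_zero_primitive f)"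
    using der by (intro continuous_at_imp_continuous_on)
      (auto intro: has_vector_derivative_continuous)
qed

text \<open>The factor 2 pays for subtracting the means of \<open>f\<close> and \<open>h\<close>; integration over a unit period
  costs nothing more.\<close>

lemma mean_zero_primitive_diff_le:
  fixes f h :: "real \<Rightarrow> 'a::euclidean_space"
  assumes f: "periodic f" "continuous_on UNIV f"
    and h: "periodic h" "continuous_on UNIV h"
    and B: "\<And>s. norm (f s - h s) \<le> B"
  shows "norm (mean_zero_primitive f s - mean_zero_primitive h s) \<le> 2 * B"
proof -
  have cf: "continuous_on T f" and ch: "continuous_on T h" for T
    using f h continuous_on_subset by blast+
  let ?w' = "\<lambda>s. (f s - integral {0..1} f) - (h s - integral {0..1} h)"
  have "integral {0..1} f - integral {0..1} h = integral {0..1} (\<lambda>s. f s - h s)"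
    by (intro integral_diff[symmetric] integrable_continuous_real cf ch)
  also have "norm \<dots> \<le> integral {0..1} (\<lambda>s::real. B)"
    by (intro integral_norm_bound_integral integrable_continuous_real continuous_intros cf ch B)
  finally have mB: "norm (integral {0..1} f - integral {0..1} h) \<le> B" by simp
  show ?thesis
  proof (rule mean_zero_norm_le_derivative_bound
      [where w = "\<lambda>s. mean_zero_primitive f s - mean_zero_primitive h s" and w' = ?w'])
    show "((\<lambda>s. mean_zero_primitive f s - mean_zero_primitive h s) has_vector_derivative ?w' s) (at s)"
      for s by (intro has_vector_derivative_diff mean_zero_primitive_derivative f h)
    show "continuous_on UNIV ?w'" by (intro continuous_intros cf ch)
    show "periodic (\<lambda>s. mean_zero_primitive f s - mean_zero_primitive h s)"
      using periodic_mean_zero_primitive[OF f] periodic_mean_zero_primitive[OF h]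
      by (simp add: periodic_def)
    show "integral {0..1} (\<lambda>s. mean_zero_primitive f s - mean_zero_primitive h s) = 0"
      using mean_mean_zero_primitive[OF f] mean_mean_zero_primitive[OF h]
      by (subst integral_diff) (auto intro!: integrable_continuous_real
          continuous_on_subset[OF continuous_mean_zero_primitive] f h)
    show "norm (?w' s) \<le> 2 * B" for s
    proof -
      have "?w' s = (f s - h s) - (integral {0..1} f - integral {0..1} h)" by simp
      also have "norm \<dots> \<le> norm (f s - h s) + norm (integral {0..1} f - integral {0..1} h)"
        by (rule norm_triangle_ineq4)
      finally show ?thesis using B[of s] mB by linarith
    qed
  qed
qed

section \<open>Curves of prescribed mean position\<close>

text \<open>The constant \<open>1 / 8\<close> serves three purposes: it makes the fixed-point map below, whose Lipschitz
  constant is at most \<open>4 * L\<close>, a contraction with factor \<open>1 / 2\<close>; it keeps \<open>L \<le> 1 / 2\<close>, which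
  Wirtinger's inequality needs to dominate the concavity of the potential term in the action; and
  it keeps \<open>L < 1\<close>, so that the linear term in \<open>V_taylor\<close> decides the sign when the displacement is the mean force.\<close>

locale weak_periodic_force =
  fixes V :: "'a::euclidean_space \<Rightarrow> real" and g :: "'a \<Rightarrow> 'a" and L :: real and e :: 'a
  assumes gradient: "(V has_derivative (\<lambda>h. g x \<bullet> h)) (at x)"
    and lipschitz: "norm (g x - g y) \<le> L * norm (x - y)"
    and weak: "L \<le> 1 / 8"
    and V_period: "V (x + e) = V x"
begin

lemma L_nonneg: "0 \<le> L"
proof -
  obtain b :: 'a where "b \<in> Basis" using nonempty_Basis by blast
  then have "norm (g b - g 0) \<le> L" using lipschitz[of b 0] by simp
  then show ?thesis using norm_ge_zero order_trans by blast
qed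

lemma g_period: "g (x + e) = g x"
proof -
  have "((\<lambda>y. V (y + e)) has_derivative (\<lambda>h. g (x + e) \<bullet> h)) (at x)"
    by (rule has_derivative_compose[of "\<lambda>y. y + e" "\<lambda>h. h", OF _ gradient, simplified])
      (auto intro!: derivative_eq_intros)
  then have "(\<lambda>h. g (x + e) \<bullet> h) = (\<lambda>h. g x \<bullet> h)"
    using gradient[of x] has_derivative_unique by (simp add: V_period) blast
  then show ?thesis by (metis inner_commute vector_eq_ldot)
qed

lemma continuous_g: "continuous_on S g"
proof (rule continuous_on_subset[of UNIV])
  have "L-lipschitz_on UNIV g"
    using lipschitz L_nonneg by (auto simp: lipschitz_on_def dist_norm)
  then show "continuous_on UNIV g" by (rule lipschitz_on_continuous_on)
qed simp

lemma continuous_V: "continuous_on S V"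
  by (intro continuous_at_imp_continuous_on ballI has_derivative_continuous[OF gradient])

lemma V_taylor: "\<bar>V (x + h) - V x - g x \<bullet> h\<bar> \<le> L * (norm h)\<^sup>2"
proof -
  have "\<exists>t. 0 < t \<and> t < 1 \<and> V (x + 1 *\<^sub>R h) - V (x + 0 *\<^sub>R h) = (1 - 0) * (g (x + t *\<^sub>R h) \<bullet> h)"
  proof (rule MVT2)
    show "((\<lambda>t. V (x + t *\<^sub>R h)) has_real_derivative g (x + t *\<^sub>R h) \<bullet> h) (at t)" for t
      unfolding has_field_derivative_def
      by (rule has_derivative_eq_rhs, rule has_derivative_compose[OF _ gradient])
        (auto intro!: derivative_eq_intros simp: mult_ac)
  qed auto
  then obtain t where t: "0 < t" "t < 1" and eq: "V (x + h) - V x = g (x + t *\<^sub>R h) \<bullet> h" by auto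
  have "\<bar>V (x + h) - V x - g x \<bullet> h\<bar> = \<bar>(g (x + t *\<^sub>R h) - g x) \<bullet> h\<bar>"
    by (simp add: eq inner_diff_left)
  also have "\<dots> \<le> norm (g (x + t *\<^sub>R h) - g x) * norm h" by (rule Cauchy_Schwarz_ineq2)
  also have "\<dots> \<le> (L * norm h) * norm h"
  proof (rule mult_right_mono)
    have "norm (g (x + t *\<^sub>R h) - g x) \<le> L * (t * norm h)" using lipschitz[of "x + t *\<^sub>R h" x] t by simp
    also have "\<dots> \<le> L * norm h" using t L_nonneg by (intro mult_left_mono mult_left_le_one_le) auto
    finally show "norm (g (x + t *\<^sub>R h) - g x) \<le> L * norm h" .
  qed simp
  finally show ?thesis by (simp add: power2_eq_square mult_ac)
qed

definition winding_curve :: "'a \<Rightarrow> (real \<Rightarrow> 'a) \<Rightarrow> real \<Rightarrow> 'a" where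
  "winding_curve a u s = a + s *\<^sub>R e + u s"

lemma winding_curve_force:
  assumes "periodic u" "continuous_on UNIV u"
  shows "periodic (\<lambda>s. g (winding_curve a u s))"
    and "continuous_on S (\<lambda>s. g (winding_curve a u s))"
    and "continuous_on S (winding_curve a u)"
proof -
  have "winding_curve a u (s + 1) = winding_curve a u s + e" for s
    using assms(1) by (simp add: winding_curve_def periodic_def scaleR_add_left)
  then show "periodic (\<lambda>s. g (winding_curve a u s))"
    by (simp add: periodic_def g_period)
  show c: "continuous_on S (winding_curve a u)" for S
    unfolding winding_curve_def by (intro continuous_intros continuous_on_subset[OF assms(2)]) simp
  show "continuous_on S (\<lambda>s. g (winding_curve a u s))"
    by (rule continuous_on_compose2[OF continuous_g c]) auto
qed

text \<open>One step of the Picard iteration for \<open>u'' = - (g(\<phi>) - mean of g(\<phi>))\<close>: the velocity and the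
  position obtained from the force along the current curve. The mean of the force is dropped
  automatically by \<^const>\<open>mean_zero_primitive\<close>.\<close>

definition corrected_velocity :: "'a \<Rightarrow> (real \<Rightarrow> 'a) \<Rightarrow> real \<Rightarrow> 'a" where
  "corrected_velocity a u s = - mean_zero_primitive (\<lambda>s. g (winding_curve a u s)) s"

definition corrected_position :: "'a \<Rightarrow> (real \<Rightarrow> 'a) \<Rightarrow> real \<Rightarrow> 'a" where
  "corrected_position a u = mean_zero_primitive (corrected_velocity a u)"

lemma corrected_velocity_properties:
  assumes "periodic u" "continuous_on UNIV u"
  shows "periodic (corrected_velocity a u)"
    and "continuous_on S (corrected_velocity a u)"
    and "integral {0..1} (corrected_velocity a u) = 0"
    and "(corrected_velocity a u has_vector_derivative
           (integral {0..1} (\<lambda>s. g (winding_curve a u s)) - g (winding_curve a u s))) (at s)"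
proof -
  note f = winding_curve_force(1,2)[OF assms, where a=a]
  show "periodic (corrected_velocity a u)"
    using periodic_mean_zero_primitive[OF f] by (simp add: periodic_def corrected_velocity_def)
  show "continuous_on S (corrected_velocity a u)"
    unfolding corrected_velocity_def
    by (intro continuous_intros continuous_on_subset[OF continuous_mean_zero_primitive[OF f]]) simp
  show "integral {0..1} (corrected_velocity a u) = 0"
    unfolding corrected_velocity_def using mean_mean_zero_primitive[OF f] by simp
  have "(corrected_velocity a u has_vector_derivative
      - (g (winding_curve a u s) - integral {0..1} (\<lambda>s. g (winding_curve a u s)))) (at s)"
    unfolding corrected_velocity_def
    by (intro has_vector_derivative_minus mean_zero_primitive_derivative f)
  then show "(corrected_velocity a u has_vector_derivative
           (integral {0..1} (\<lambda>s. g (winding_curve a u s)) - g (winding_curve a u s))) (at s)"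
    by simp
qed

lemma corrected_position_properties:
  assumes "periodic u" "continuous_on UNIV u"
  shows "periodic (corrected_position a u)"
    and "continuous_on S (corrected_position a u)"
    and "integral {0..1} (corrected_position a u) = 0"
    and "(corrected_position a u has_vector_derivative corrected_velocity a u s) (at s)"
proof -
  note v = corrected_velocity_properties(1,2)[OF assms, where a=a]
  show "periodic (corrected_position a u)"
    unfolding corrected_position_def by (rule periodic_mean_zero_primitive[OF v])
  show "continuous_on S (corrected_position a u)"
    unfolding corrected_position_def
    by (rule continuous_on_subset[OF continuous_mean_zero_primitive[OF v]]) simp
  show "integral {0..1} (corrected_position a u) = 0"
    unfolding corrected_position_def by (rule mean_mean_zero_primitive[OF v])
  show "(corrected_position a u has_vector_derivative corrected_velocity a u s) (at s)"
    using mean_zero_primitive_derivative[OF v, of s] corrected_velocity_properties(3)[OF assms]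
    by (simp add: corrected_position_def)
qed

text \<open>Varying the base point \<open>a\<close> together with \<open>u\<close> gives at once the contraction property (for
  \<open>a = b\<close>) and the Lipschitz dependence of the fixed point on \<open>a\<close>.\<close>

lemma corrected_diff_le:
  assumes u: "periodic u" "continuous_on UNIV u"
    and w: "periodic w" "continuous_on UNIV w"
    and B: "\<And>s. norm (u s - w s) \<le> B"
  shows "norm (corrected_velocity a u s - corrected_velocity b w s) \<le> (norm (a - b) + B) / 4"
    and "norm (corrected_position a u s - corrected_position b w s) \<le> (norm (a - b) + B) / 2"
proof -
  have "norm (g (winding_curve a u s) - g (winding_curve b w s)) \<le> (norm (a - b) + B) / 8" for s
  proof -
    have "norm (winding_curve a u s - winding_curve b w s) = norm ((a - b) + (u s - w s))"
      by (simp add: winding_curve_def algebra_simps)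
    also have "\<dots> \<le> norm (a - b) + B"
      using norm_triangle_ineq[of "a - b" "u s - w s"] B[of s] by linarith
    finally have le: "norm (winding_curve a u s - winding_curve b w s) \<le> norm (a - b) + B" .
    have "norm (g (winding_curve a u s) - g (winding_curve b w s))
        \<le> L * norm (winding_curve a u s - winding_curve b w s)" by (rule lipschitz)
    also have "\<dots> \<le> 1 / 8 * (norm (a - b) + B)"
      using weak le by (intro mult_mono) auto
    finally show ?thesis by simp
  qed
  then have "norm (mean_zero_primitive (\<lambda>s. g (winding_curve a u s)) s
      - mean_zero_primitive (\<lambda>s. g (winding_curve b w s)) s) \<le> 2 * ((norm (a - b) + B) / 8)" for s
    by (intro mean_zero_primitive_diff_le winding_curve_force u w)
  note prim = this
  show v: "norm (corrected_velocity a u s - corrected_velocity b w s) \<le> (norm (a - b) + B) / 4" for s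
    using prim[of s] by (simp add: corrected_velocity_def norm_minus_commute)
  have "norm (corrected_position a u s - corrected_position b w s) \<le> 2 * ((norm (a - b) + B) / 4)"
    unfolding corrected_position_def
    by (intro mean_zero_primitive_diff_le corrected_velocity_properties u w v)
  then show "norm (corrected_position a u s - corrected_position b w s) \<le> (norm (a - b) + B) / 2"
    by simp
qed

lemma fixed_correction_exists:
  "\<exists>u. periodic u \<and> continuous_on UNIV u \<and> corrected_position a u = u"
proof -
  define X :: "(real \<Rightarrow>\<^sub>C 'a) set" where "X = {u. periodic (apply_bcontfun u)}"
  define T where "T u = Bcontfun (corrected_position a (apply_bcontfun u))" for u :: "real \<Rightarrow>\<^sub>C 'a"
  have T: "apply_bcontfun (T u) = corrected_position a (apply_bcontfun u)" if "u \<in> X" for u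
    unfolding T_def using that
    by (intro Bcontfun_inverse periodic_continuous_imp_bcontfun corrected_position_properties)
      (auto simp: X_def)
  have "\<exists>!u. u \<in> X \<and> T u = u"
  proof (rule Banach_fix[where c = "1/2"])
    have "closed X"
      unfolding closed_sequential_limits
    proof safe
      fix f and u :: "real \<Rightarrow>\<^sub>C 'a" assume f: "\<forall>n. f n \<in> X" and lim: "f \<longlonglongrightarrow> u"
      have ptw: "(\<lambda>n. apply_bcontfun (f n) s) \<longlonglongrightarrow> apply_bcontfun u s" for s
      proof (rule metric_tendsto_imp_tendsto[OF lim])
        show "\<forall>\<^sub>F n in sequentially. dist (apply_bcontfun (f n) s) (apply_bcontfun u s) \<le> dist (f n) u"
          by (intro always_eventually allI dist_bounded)
      qed
      have "apply_bcontfun u (s + 1) = apply_bcontfun u s" for s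
        using f ptw[of "s + 1"] ptw[of s] by (auto simp: X_def periodic_def intro: LIMSEQ_unique)
      then show "u \<in> X" by (simp add: X_def periodic_def)
    qed
    then show "complete X" by (simp add: complete_eq_closed)
    have "const_bcontfun 0 \<in> X"
      by (simp add: X_def periodic_def const_bcontfun.rep_eq)
    then show "X \<noteq> {}" by blast
    show "T ` X \<subseteq> X"
      using corrected_position_properties(1) T by (auto simp: X_def)
    show "dist (T u) (T w) \<le> 1 / 2 * dist u w" if "u \<in> X" "w \<in> X" for u w
    proof (rule dist_bound)
      fix s
      have "norm (corrected_position a (apply_bcontfun u) s - corrected_position a (apply_bcontfun w) s)
          \<le> (norm (a - a) + dist u w) / 2"
        using that dist_bounded[of u _ w] by (intro corrected_diff_le) (auto simp: X_def dist_norm)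
      then show "dist (apply_bcontfun (T u) s) (apply_bcontfun (T w) s) \<le> 1 / 2 * dist u w"
        using that by (simp add: T dist_norm)
    qed
  qed auto
  then obtain u where "u \<in> X" "T u = u" by blast
  then have "corrected_position a (apply_bcontfun u) = apply_bcontfun u"
    using T[of u] by simp
  then show ?thesis using \<open>u \<in> X\<close> by (auto simp: X_def)
qed

definition correction :: "'a \<Rightarrow> real \<Rightarrow> 'a" where
  "correction a = (SOME u. periodic u \<and> continuous_on UNIV u \<and> corrected_position a u = u)"

definition correction_velocity :: "'a \<Rightarrow> real \<Rightarrow> 'a" where
  "correction_velocity a = corrected_velocity a (correction a)"

definition mean_curve :: "'a \<Rightarrow> real \<Rightarrow> 'a" where
  "mean_curve a = winding_curve a (correction a)"

lemma correction_fixed: "corrected_position a (correction a) = correction a"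
  and periodic_correction: "periodic (correction a)"
  and continuous_correction_UNIV: "continuous_on UNIV (correction a)"
  using someI_ex[OF fixed_correction_exists[of a], folded correction_def] by blast+

lemma continuous_correction: "continuous_on S (correction a)"
  by (rule continuous_on_subset[OF continuous_correction_UNIV]) simp

lemmas correction_regular = periodic_correction continuous_correction_UNIV

lemma correction_derivative:
  "(correction a has_vector_derivative correction_velocity a s) (at s)"
  unfolding correction_velocity_def
  using corrected_position_properties(4)[OF correction_regular, of a a s] by (simp add: correction_fixed)

lemma correction_mean: "integral {0..1} (correction a) = 0"
  using corrected_position_properties(3)[OF correction_regular, of a a] by (simp add: correction_fixed)

lemma correction_velocity_derivative:
  "(correction_velocity a has_vector_derivative
     (integral {0..1} (\<lambda>s. g (mean_curve a s)) - g (mean_curve a s))) (at s)"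
  unfolding correction_velocity_def mean_curve_def
  by (rule corrected_velocity_properties(4)[OF correction_regular])

lemma periodic_correction_velocity: "periodic (correction_velocity a)"
  and continuous_correction_velocity: "continuous_on S (correction_velocity a)"
  unfolding correction_velocity_def
  by (rule corrected_velocity_properties[OF correction_regular])+

lemma continuous_mean_curve: "continuous_on S (mean_curve a)"
  unfolding mean_curve_def by (rule winding_curve_force[OF correction_regular])

lemma continuous_g_mean_curve: "continuous_on S (\<lambda>s. g (mean_curve a s))"
  unfolding mean_curve_def by (rule winding_curve_force[OF correction_regular])

text \<open>The distance \<open>d\<close> between two fixed points satisfies \<open>d \<le> (norm (a - b) + d) / 2\<close>.\<close>

lemma correction_lipschitz: "norm (correction a s - correction b s) \<le> norm (a - b)"
proof -
  define f where "f = Bcontfun (correction a)"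
  define h where "h = Bcontfun (correction b)"
  have f: "apply_bcontfun f = correction a" and h: "apply_bcontfun h = correction b"
    unfolding f_def h_def
    by (intro Bcontfun_inverse periodic_continuous_imp_bcontfun correction_regular)+
  have *: "norm (correction a s - correction b s) \<le> dist f h" for s
    using dist_bounded[of f s h] by (simp add: f h dist_norm)
  have "dist f h \<le> (norm (a - b) + dist f h) / 2"
  proof (rule dist_bound)
    fix s
    show "dist (apply_bcontfun f s) (apply_bcontfun h s) \<le> (norm (a - b) + dist f h) / 2"
      using corrected_diff_le(2)[where a = a and b = b and u = "correction a" and w = "correction b"
          and s = s, OF correction_regular correction_regular *]
      by (simp add: f h dist_norm correction_fixed)
  qed
  then show ?thesis using *[of s] by simp
qed

lemma correction_velocity_lipschitz:
  "norm (correction_velocity a s - correction_velocity b s) \<le> norm (a - b)"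
proof -
  have "norm (correction_velocity a s - correction_velocity b s) \<le> (norm (a - b) + norm (a - b)) / 4"
    unfolding correction_velocity_def
    by (rule corrected_diff_le(1)[OF correction_regular correction_regular correction_lipschitz])
  also have "\<dots> \<le> norm (a - b)" using norm_ge_zero[of "a - b"] by simp
  finally show ?thesis .
qed

section \<open>The reduced action\<close>

definition action :: "(real \<Rightarrow> 'a) \<Rightarrow> (real \<Rightarrow> 'a) \<Rightarrow> real" where
  "action \<phi> v = integral {0..1} (\<lambda>s. (norm (v s))\<^sup>2 / 2 - V (\<phi> s))"

definition reduced_action :: "'a \<Rightarrow> real" where
  "reduced_action a = action (mean_curve a) (\<lambda>s. e + correction_velocity a s)"

text \<open>The curve \<open>mean_curve b + h\<close> is a competitor of \<open>mean_curve (b + h)\<close>: both have the form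
  \<open>b + h + s e\<close> plus a mean-zero periodic term. With \<open>w\<close> their difference, the first-order part of
  the change of action vanishes because \<open>mean_curve (b + h)\<close> solves its equation up to a constant
  force, which is orthogonal to the mean-zero \<open>w\<close>. The second-order part is nonnegative by
  Wirtinger's inequality.\<close>

lemma reduced_action_le:
  "reduced_action (b + h) \<le> action (\<lambda>s. mean_curve b s + h) (\<lambda>s. e + correction_velocity b s)"
proof -
  define a where "a = b + h"
  define w where "w s = correction b s - correction a s" for s
  define z where "z s = correction_velocity b s - correction_velocity a s" for s
  define v where "v = correction_velocity a"
  define \<phi> where "\<phi> = mean_curve a"
  define m where "m = integral {0..1} (\<lambda>s. g (\<phi> s))"
  note cont = continuous_correction continuous_correction_velocity continuous_mean_curve
    continuous_g_mean_curve
  have cw: "continuous_on S w" and cz: "continuous_on S z" and cv: "continuous_on S v"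
    and c\<phi>: "continuous_on S \<phi>" and cg: "continuous_on S (\<lambda>s. g (\<phi> s))" for S
    unfolding w_def z_def v_def \<phi>_def by (intro continuous_intros cont)+
  have \<psi>: "mean_curve b s + h = \<phi> s + w s" for s
    by (simp add: \<phi>_def mean_curve_def winding_curve_def w_def a_def)
  have wz: "(w has_vector_derivative z s) (at s)" for s
    unfolding w_def z_def by (intro has_vector_derivative_diff correction_derivative)
  have v': "(v has_vector_derivative (m - g (\<phi> s))) (at s)" for s
    unfolding v_def m_def \<phi>_def by (rule correction_velocity_derivative)
  have pw: "periodic w" and pv: "periodic v"
    using periodic_correction[of a] periodic_correction[of b] periodic_correction_velocity[of a]
    by (simp_all add: w_def v_def periodic_def)
  have mw: "integral {0..1} w = 0"
    unfolding w_def using correction_mean by (subst integral_diff) (auto intro!: integrable_continuous_real cont)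
  have w0: "(w has_integral 0) {0..1}"
    using mw cw by (metis integrable_integral integrable_continuous_real)
  have z0: "(z has_integral 0) {0..1}" by (rule integral_derivative_periodic[OF wz pw])
  \<comment> \<open>Integration by parts: this is the weak form of the equation for \<open>v\<close>, tested against \<open>w\<close>.\<close>
  have "((\<lambda>s. v s \<bullet> z s + (m - g (\<phi> s)) \<bullet> w s) has_integral 0) {0..1}"
  proof (rule integral_derivative_periodic)
    show "((\<lambda>s. v s \<bullet> w s) has_vector_derivative v s \<bullet> z s + (m - g (\<phi> s)) \<bullet> w s) (at s)" for s
      by (rule bounded_bilinear.has_vector_derivative[OF bounded_bilinear_inner v' wz])
    show "periodic (\<lambda>s. v s \<bullet> w s)" using pw pv by (simp add: periodic_def)
  qed
  moreover have "((\<lambda>s. m \<bullet> w s) has_integral m \<bullet> 0) {0..1}"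
    using has_integral_linear[OF w0 bounded_linear_inner_right[of m]] by (simp add: o_def)
  moreover have "((\<lambda>s. e \<bullet> z s) has_integral e \<bullet> 0) {0..1}"
    using has_integral_linear[OF z0 bounded_linear_inner_right[of e]] by (simp add: o_def)
  ultimately have "((\<lambda>s. (v s \<bullet> z s + (m - g (\<phi> s)) \<bullet> w s) - m \<bullet> w s + e \<bullet> z s)
      has_integral 0 - m \<bullet> 0 + e \<bullet> 0) {0..1}"
    by (intro has_integral_add has_integral_diff)
  then have first: "((\<lambda>s. (e + v s) \<bullet> z s - g (\<phi> s) \<bullet> w s) has_integral 0) {0..1}"
    by (simp add: algebra_simps)
  \<comment> \<open>By Taylor expansion the remaining second-order part is at least \<open>r s\<close>.\<close>
  define r where "r s = (norm (z s))\<^sup>2 / 2 - L * (norm (w s))\<^sup>2" for s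
  have "integral {0..1} (\<lambda>s. (norm (z s))\<^sup>2) / 2 - L * integral {0..1} (\<lambda>s. (norm (w s))\<^sup>2) \<ge> 0"
  proof -
    have "L * integral {0..1} (\<lambda>s. (norm (w s))\<^sup>2) \<le> 1/2 * integral {0..1} (\<lambda>s. (norm (z s))\<^sup>2)"
      using weak L_nonneg wirtinger_inequality[OF wz cz pw mw]
      by (intro mult_mono integral_nonneg integrable_continuous_real continuous_intros cw) auto
    then show ?thesis by simp
  qed
  also have "integral {0..1} (\<lambda>s. (norm (z s))\<^sup>2) / 2 - L * integral {0..1} (\<lambda>s. (norm (w s))\<^sup>2)
      = integral {0..1} r"
    unfolding r_def
    by (subst integral_diff, (intro integrable_continuous_real continuous_intros cw cz; simp)+) simp
  finally have r: "0 \<le> integral {0..1} r" .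
  have le: "((norm (e + v s))\<^sup>2 / 2 - V (\<phi> s)) + ((e + v s) \<bullet> z s - g (\<phi> s) \<bullet> w s) + r s
      \<le> (norm (e + correction_velocity b s))\<^sup>2 / 2 - V (mean_curve b s + h)" for s
  proof -
    have "e + correction_velocity b s = (e + v s) + z s" by (simp add: v_def z_def)
    then have "(norm (e + correction_velocity b s))\<^sup>2
        = (norm (e + v s))\<^sup>2 + 2 * ((e + v s) \<bullet> z s) + (norm (z s))\<^sup>2"
      unfolding power2_norm_eq_inner
      by (simp only: inner_add_left inner_add_right inner_commute) simp
    moreover have "V (\<phi> s + w s) - V (\<phi> s) - g (\<phi> s) \<bullet> w s \<le> L * (norm (w s))\<^sup>2"
      using V_taylor[of "\<phi> s" "w s"] by linarith
    ultimately show ?thesis unfolding \<psi> r_def by argo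
  qed
  have cV: "continuous_on {0..1} (\<lambda>s. V (\<phi> s))"
    by (rule continuous_on_compose2[OF continuous_V[of UNIV] c\<phi>]) simp
  have c1: "continuous_on {0..1} (\<lambda>s. (norm (e + v s))\<^sup>2 / 2 - V (\<phi> s))"
    and c2: "continuous_on {0..1} (\<lambda>s. (e + v s) \<bullet> z s - g (\<phi> s) \<bullet> w s)"
    and c3: "continuous_on {0..1} r"
    unfolding r_def by (intro continuous_intros cw cz cg cv cV; simp)+
  have "reduced_action a + integral {0..1} (\<lambda>s. (e + v s) \<bullet> z s - g (\<phi> s) \<bullet> w s)
        + integral {0..1} r
      = integral {0..1} (\<lambda>s. ((norm (e + v s))\<^sup>2 / 2 - V (\<phi> s))
          + ((e + v s) \<bullet> z s - g (\<phi> s) \<bullet> w s) + r s)"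
    unfolding reduced_action_def action_def \<phi>_def[symmetric] v_def[symmetric]
    by (subst integral_add[OF integrable_continuous_real[OF continuous_on_add[OF c1 c2]] integrable_continuous_real[OF c3]],
        subst integral_add[OF integrable_continuous_real[OF c1] integrable_continuous_real[OF c2]]) (rule refl)
  also have "\<dots> \<le> action (\<lambda>s. mean_curve b s + h) (\<lambda>s. e + correction_velocity b s)"
    unfolding action_def
  proof (rule integral_le)
    show "(\<lambda>s. (norm (e + v s))\<^sup>2 / 2 - V (\<phi> s) + ((e + v s) \<bullet> z s - g (\<phi> s) \<bullet> w s) + r s) integrable_on {0..1}"
      by (intro integrable_continuous_real continuous_on_add c1 c2 c3)
    show "(\<lambda>s. (norm (e + correction_velocity b s))\<^sup>2 / 2 - V (mean_curve b s + h)) integrable_on {0..1}"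
      by (intro integrable_continuous_real continuous_intros cont
          continuous_on_compose2[OF continuous_V[of UNIV]] subset_UNIV; simp)
  qed (rule le)
  finally show ?thesis using r by (simp add: integral_unique[OF first] a_def)
qed

text \<open>The curves and their velocities are continuous in time and Lipschitz in \<open>a\<close> uniformly in time,
  hence jointly continuous.\<close>

lemma continuous_reduced_action: "continuous_on S reduced_action"
proof -
  have joint: "continuous_on (S \<times> cbox 0 1) (\<lambda>x. f (fst x) (snd x))"
    if cont: "\<And>a. continuous_on UNIV (f a)" and lip: "\<And>a b s. norm (f a s - f b s) \<le> norm (a - b)"
    for f :: "'a \<Rightarrow> real \<Rightarrow> 'a"
  proof (rule continuous_at_imp_continuous_on, rule ballI)
    fix x :: "'a \<times> real"
    have "((\<lambda>y. f (fst x) (snd y) - f (fst x) (snd x)) \<longlongrightarrow> 0) (at x)"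
      using cont[of "fst x"]
      by (intro LIM_zero isCont_tendsto_compose[OF _ tendsto_snd] tendsto_ident_at)
        (simp add: continuous_on_eq_continuous_at)
    moreover have "((\<lambda>y. f (fst y) (snd y) - f (fst x) (snd y)) \<longlongrightarrow> 0) (at x)"
    proof (rule Lim_null_comparison)
      show "\<forall>\<^sub>F y in at x. norm (f (fst y) (snd y) - f (fst x) (snd y)) \<le> norm (fst y - fst x)"
        using lip by simp
      show "((\<lambda>y. norm (fst y - fst x)) \<longlongrightarrow> 0) (at x)"
        by (intro tendsto_norm_zero LIM_zero tendsto_fst tendsto_ident_at)
    qed
    ultimately have "((\<lambda>y. f (fst y) (snd y) - f (fst x) (snd x)) \<longlongrightarrow> 0) (at x)"
      using tendsto_add by fastforce
    then show "isCont (\<lambda>x. f (fst x) (snd x)) x"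
      unfolding isCont_def by (rule LIM_zero_cancel)
  qed
  note jc = joint[of correction, OF continuous_correction correction_lipschitz]
  note jv = joint[of correction_velocity, OF continuous_correction_velocity correction_velocity_lipschitz]
  have "continuous_on (S \<times> cbox 0 1) (\<lambda>x. mean_curve (fst x) (snd x))"
    unfolding mean_curve_def winding_curve_def by (intro continuous_intros jc)
  then have "continuous_on (S \<times> cbox 0 1) (\<lambda>(a, s).
      (norm (e + correction_velocity a s))\<^sup>2 / 2 - V (mean_curve a s))"
    unfolding case_prod_beta
    by (intro continuous_intros jv continuous_on_compose2[OF continuous_V[of UNIV]]) auto
  then show ?thesis
    unfolding reduced_action_def action_def
    using integral_continuous_on_param[where a = "0::real" and b = 1] by simp
qed

text \<open>Translating a curve leaves its kinetic energy unchanged, so minimality of \<open>a\<close> compares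
  only the potential energies of \<open>mean_curve a\<close> and its translate.\<close>

lemma mean_force_zero_if_reduced_action_minimal:
  assumes min: "\<And>b. reduced_action a \<le> reduced_action b"
  shows "integral {0..1} (\<lambda>s. g (mean_curve a s)) = 0"
proof -
  define m where "m = integral {0..1} (\<lambda>s. g (mean_curve a s))"
  have cV: "continuous_on {0..1} (\<lambda>s. V (mean_curve a s + h))" for h
    by (intro continuous_intros continuous_on_compose2[OF continuous_V[of UNIV]] continuous_mean_curve) auto
  have cV0: "continuous_on {0..1} (\<lambda>s. V (mean_curve a s))"
    using cV[of 0] by simp
  note cont = continuous_correction_velocity continuous_g_mean_curve cV cV0
  \<comment> \<open>Translating by the mean force \<open>m\<close> itself would lower the action by about \<open>norm m ^ 2\<close>;
    the Taylor error \<open>L * norm m ^ 2\<close> is too small to compensate for this.\<close>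
  have "action (mean_curve a) (\<lambda>s. e + correction_velocity a s)
      \<le> action (\<lambda>s. mean_curve a s + m) (\<lambda>s. e + correction_velocity a s)"
    using min[of "a + m"] reduced_action_le[of a m] by (simp add: reduced_action_def)
  then have "0 \<le> action (\<lambda>s. mean_curve a s + m) (\<lambda>s. e + correction_velocity a s)
      - action (mean_curve a) (\<lambda>s. e + correction_velocity a s)" by simp
  also have "\<dots> = integral {0..1} (\<lambda>s. V (mean_curve a s) - V (mean_curve a s + m))"
    unfolding action_def
    by (subst integral_diff[symmetric], (intro integrable_continuous_real continuous_intros cont; simp)+) simp
  also have "\<dots> \<le> integral {0..1} (\<lambda>s. L * (norm m)\<^sup>2 - g (mean_curve a s) \<bullet> m)"
  proof (rule integral_le)
    show "V (mean_curve a s) - V (mean_curve a s + m) \<le> L * (norm m)\<^sup>2 - g (mean_curve a s) \<bullet> m" for s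
      using V_taylor[of "mean_curve a s" m] by linarith
  qed (intro integrable_continuous_real continuous_intros cont)+
  also have "\<dots> = L * (norm m)\<^sup>2 - integral {0..1} (\<lambda>s. g (mean_curve a s) \<bullet> m)"
    by (subst integral_diff, (intro integrable_continuous_real continuous_intros cont)+) simp
  also have "integral {0..1} (\<lambda>s. g (mean_curve a s) \<bullet> m) = m \<bullet> m"
    using integral_linear[of "\<lambda>s. g (mean_curve a s)" "{0..1}" "\<lambda>x. x \<bullet> m"]
      bounded_linear_inner_left[of m] continuous_g_mean_curve
    by (simp add: o_def m_def integrable_continuous_real)
  finally have "(norm m)\<^sup>2 \<le> L * (norm m)\<^sup>2" by (simp add: power2_norm_eq_inner)
  also have "\<dots> \<le> 1/8 * (norm m)\<^sup>2" using weak by (intro mult_right_mono) auto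
  finally have "(norm m)\<^sup>2 \<le> 0" by simp
  then show ?thesis by (simp add: m_def)
qed

text \<open>The set \<open>D\<close> meets every orbit of the translations that preserve \<open>V\<close>. Moving the base point \<open>b\<close>
  into \<open>D\<close> by such a translation does not raise the reduced action, so a minimum over \<open>D\<close> is a global one.\<close>

lemma winding_orbit_exists:
  assumes D: "compact D" "D \<noteq> {}"
    and translate: "\<And>x. \<exists>z. x + z \<in> D \<and> (\<forall>y. V (y + z) = V y)"
  shows "\<exists>\<phi> v. (\<forall>s. (\<phi> has_vector_derivative v s) (at s)) \<and>
     (\<forall>s. (v has_vector_derivative - g (\<phi> s)) (at s)) \<and> (\<forall>s. \<phi> (s + 1) = \<phi> s + e)"
proof -
  obtain a where a: "\<And>b. b \<in> D \<Longrightarrow> reduced_action a \<le> reduced_action b"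
    using continuous_attains_inf[OF D continuous_reduced_action] by blast
  have "reduced_action a \<le> reduced_action b" for b
  proof -
    obtain z where z: "b + z \<in> D" "\<And>y. V (y + z) = V y" using translate by blast
    have "reduced_action a \<le> reduced_action (b + z)" by (rule a[OF z(1)])
    also have "\<dots> \<le> action (\<lambda>s. mean_curve b s + z) (\<lambda>s. e + correction_velocity b s)"
      by (rule reduced_action_le)
    also have "\<dots> = reduced_action b"
      by (simp add: reduced_action_def action_def z(2))
    finally show ?thesis .
  qed
  then have "integral {0..1} (\<lambda>s. g (mean_curve a s)) = 0"
    by (rule mean_force_zero_if_reduced_action_minimal)
  then have "((\<lambda>s. e + correction_velocity a s) has_vector_derivative - g (mean_curve a s)) (at s)" for s
    using correction_velocity_derivative[of a s] by (auto intro!: derivative_eq_intros)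
  moreover have "(mean_curve a has_vector_derivative e + correction_velocity a s) (at s)" for s
    unfolding mean_curve_def winding_curve_def
    by (auto intro!: derivative_eq_intros correction_derivative)
  moreover have "mean_curve a (s + 1) = mean_curve a s + e" for s
    using periodic_correction[of a]
    by (simp add: mean_curve_def winding_curve_def periodic_def scaleR_add_left)
  ultimately show ?thesis
    by (intro exI[of _ "mean_curve a"] exI[of _ "\<lambda>s. e + correction_velocity a s"]) simp
qed

end

section \<open>Calculus of smooth functions\<close>

lemma Ck_on_Suc_iff:
  assumes "\<And>x. (f has_derivative f' x) (at x)"
  shows "Ck_on (Suc k) UNIV f \<longleftrightarrow> (\<forall>b\<in>Basis. Ck_on k UNIV (\<lambda>x. f' x b))"
proof -
  have "frechet_derivative f (at x) = f' x" for x
    using frechet_derivative_at[OF assms] by simp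
  then show ?thesis using assms by (auto simp: differentiable_def)
qed

lemma Ck_on_UNIV_SucD:
  assumes "Ck_on (Suc k) UNIV f"
  shows "(f has_derivative frechet_derivative f (at x)) (at x)"
    and "b \<in> Basis \<Longrightarrow> Ck_on k UNIV (\<lambda>x. frechet_derivative f (at x) b)"
  using assms by (auto simp: frechet_derivative_works)

lemma Ck_on_Suc_imp:
  "Ck_on (Suc k) UNIV f \<Longrightarrow> Ck_on k UNIV f"
proof (induction k arbitrary: f)
  case 0
  then show ?case
    by (auto intro!: continuous_at_imp_continuous_on differentiable_imp_continuous_within)
next
  case (Suc k)
  from Suc.prems show ?case by (auto intro!: Suc.IH simp del: Ck_on.simps(2) simp: Ck_on.simps(2)[of _ UNIV f])
qed

lemma Ck_on_const: "Ck_on k UNIV (\<lambda>x. c)"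
proof (induction k arbitrary: c)
  case (Suc k)
  then show ?case by (subst Ck_on_Suc_iff[of _ "\<lambda>_ _. 0"]) auto
qed simp

lemma Ck_on_linear:
  assumes "bounded_linear T" "Ck_on k UNIV f"
  shows "Ck_on k UNIV (\<lambda>x. T (f x))"
  using assms(2)
proof (induction k arbitrary: f)
  case 0
  then show ?case using assms(1) by (simp add: bounded_linear.continuous_on)
next
  case (Suc k)
  note D = Ck_on_UNIV_SucD[OF Suc.prems]
  show ?case
    by (subst Ck_on_Suc_iff[OF bounded_linear.has_derivative[OF assms(1) D(1)]])
      (auto intro: Suc.IH D(2))
qed

lemma Ck_on_add:
  assumes "Ck_on k UNIV f" "Ck_on k UNIV g"
  shows "Ck_on k UNIV (\<lambda>x. f x + g x)"
  using assms
proof (induction k arbitrary: f g)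
  case 0
  then show ?case by (simp add: continuous_on_add)
next
  case (Suc k)
  note D = Ck_on_UNIV_SucD[OF Suc.prems(1)] Ck_on_UNIV_SucD[OF Suc.prems(2)]
  show ?case
    by (subst Ck_on_Suc_iff[OF has_derivative_add[OF D(1) D(3)]]) (auto intro: Suc.IH D)
qed

lemma Ck_on_sum:
  assumes "\<And>i. i \<in> I \<Longrightarrow> Ck_on k UNIV (f i)"
  shows "Ck_on k UNIV (\<lambda>x. \<Sum>i\<in>I. f i x)"
  using assms by (induction I rule: infinite_finite_induct) (auto intro: Ck_on_const Ck_on_add)

lemma Ck_on_bilinear:
  assumes "bounded_bilinear p" "Ck_on k UNIV f" "Ck_on k UNIV g"
  shows "Ck_on k UNIV (\<lambda>x. p (f x) (g x))"
  using assms(2,3)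
proof (induction k arbitrary: f g)
  case 0
  then show ?case using assms(1) by (simp add: bounded_bilinear.continuous_on)
next
  case (Suc k)
  note D = Ck_on_UNIV_SucD[OF Suc.prems(1)] Ck_on_UNIV_SucD[OF Suc.prems(2)]
  show ?case
    by (subst Ck_on_Suc_iff[OF bounded_bilinear.FDERIV[OF assms(1) D(1) D(3)]])
      (intro ballI Ck_on_add Suc.IH D(2,4) Ck_on_Suc_imp[OF Suc.prems(1)] Ck_on_Suc_imp[OF Suc.prems(2)])
qed

text \<open>The chain rule in coordinates writes each partial derivative of \<open>F \<circ> Q\<close> as a sum of products
  of partial derivatives of \<open>Q\<close> with partial derivatives of \<open>F\<close> composed with \<open>Q\<close>; the latter are
  handled by induction, which is why \<open>F\<close> is generalised and \<open>Q\<close> is not.\<close>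

lemma Ck_on_compose:
  fixes F :: "'b::euclidean_space \<Rightarrow> 'c::real_normed_vector" and Q :: "'a::euclidean_space \<Rightarrow> 'b"
  assumes "Ck_on k UNIV F" "Ck_on k UNIV Q"
  shows "Ck_on k UNIV (\<lambda>x. F (Q x))"
  using assms
proof (induction k arbitrary: F)
  case 0
  then show ?case by (auto intro: continuous_on_compose2)
next
  case (Suc k)
  note DF = Ck_on_UNIV_SucD[OF Suc.prems(1)] and DQ = Ck_on_UNIV_SucD[OF Suc.prems(2)]
  have der: "((\<lambda>x. F (Q x)) has_derivative
      (\<lambda>h. \<Sum>c\<in>Basis. (frechet_derivative Q (at x) h \<bullet> c) *\<^sub>R frechet_derivative F (at (Q x)) c)) (at x)" for x
  proof (rule has_derivative_eq_rhs[OF has_derivative_compose[OF DQ(1) DF(1)]])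
    have lin: "linear (frechet_derivative F (at (Q x)))"
      using DF(1) has_derivative_linear by blast
    show "(\<lambda>h. frechet_derivative F (at (Q x)) (frechet_derivative Q (at x) h)) =
      (\<lambda>h. \<Sum>c\<in>Basis. (frechet_derivative Q (at x) h \<bullet> c) *\<^sub>R frechet_derivative F (at (Q x)) c)"
    proof
      fix h
      let ?y = "frechet_derivative Q (at x) h"
      have "frechet_derivative F (at (Q x)) ?y
          = frechet_derivative F (at (Q x)) (\<Sum>c\<in>Basis. (?y \<bullet> c) *\<^sub>R c)"
        by (simp add: euclidean_representation)
      also have "\<dots> = (\<Sum>c\<in>Basis. (?y \<bullet> c) *\<^sub>R frechet_derivative F (at (Q x)) c)"
        by (simp add: linear_sum[OF lin] linear_cmul[OF lin])
      finally show "frechet_derivative F (at (Q x)) ?y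
          = (\<Sum>c\<in>Basis. (?y \<bullet> c) *\<^sub>R frechet_derivative F (at (Q x)) c)" .
    qed
  qed
  show ?case
    by (subst Ck_on_Suc_iff[OF der])
      (intro ballI Ck_on_sum Ck_on_bilinear[OF bounded_bilinear_scaleR] DQ(2)
        Ck_on_linear[OF bounded_linear_inner_left] Suc.IH[OF DF(2)] Ck_on_Suc_imp[OF Suc.prems(2)])
qed

lemma Ck_on_bounded_linear:
  fixes T :: "'a::euclidean_space \<Rightarrow> 'b::real_normed_vector"
  assumes "bounded_linear T"
  shows "Ck_on k UNIV T"
proof (cases k)
  case 0
  then show ?thesis using linear_continuous_on[OF assms] by simp
next
  case (Suc n)
  then show ?thesis
    by (simp only: Ck_on_Suc_iff[OF bounded_linear_imp_has_derivative[OF assms]]) (auto intro: Ck_on_const)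
qed

text \<open>Bootstrapping: each pass through the equation gains one derivative of \<open>v\<close>, hence of \<open>\<phi>\<close>.\<close>

lemma Ck_on_second_order_ode:
  fixes \<phi> v :: "real \<Rightarrow> 'a::euclidean_space"
  assumes \<phi>: "\<And>s. (\<phi> has_vector_derivative v s) (at s)"
    and v: "\<And>s. (v has_vector_derivative f (\<phi> s)) (at s)"
    and f: "\<And>k. Ck_on k UNIV f"
  shows "Ck_on k UNIV \<phi> \<and> Ck_on k UNIV v"
proof (induction k)
  case 0
  then show ?case
    unfolding Ck_on.simps
    by (intro conjI continuous_at_imp_continuous_on ballI
        has_vector_derivative_continuous[OF \<phi>] has_vector_derivative_continuous[OF v])
next
  case (Suc k)
  have "Ck_on k UNIV (\<lambda>s. f (\<phi> s))"
    by (rule Ck_on_compose[OF f conjunct1[OF Suc]])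
  then have "Ck_on (Suc k) UNIV v"
    by (subst Ck_on_Suc_iff[OF v[unfolded has_vector_derivative_def]])
      (intro ballI Ck_on_linear[OF bounded_linear_scaleR_right])
  moreover have "Ck_on (Suc k) UNIV \<phi>"
    by (subst Ck_on_Suc_iff[OF \<phi>[unfolded has_vector_derivative_def]])
      (intro ballI Ck_on_linear[OF bounded_linear_scaleR_right] conjunct2[OF Suc])
  ultimately show ?case by (intro conjI)
qed

lemma lipschitz_if_partial_derivatives_bounded:
  fixes f :: "'a::euclidean_space \<Rightarrow> 'b::real_normed_vector" and B :: real
  assumes f: "\<And>x. (f has_derivative f' x) (at x)"
    and B: "\<And>x b. b \<in> Basis \<Longrightarrow> norm (f' x b) \<le> B"
  shows "norm (f x - f y) \<le> (DIM('a) * B) * norm (x - y)"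
proof (rule differentiable_bound[of UNIV f f'])
  show "onorm (f' z) \<le> DIM('a) * B" for z
  proof (rule onorm_le)
    fix h
    have lin: "linear (f' z)" using f has_derivative_linear by blast
    have "f' z h = f' z (\<Sum>b\<in>Basis. (h \<bullet> b) *\<^sub>R b)" by (simp add: euclidean_representation)
    also have "\<dots> = (\<Sum>b\<in>Basis. (h \<bullet> b) *\<^sub>R f' z b)"
      by (simp add: linear_sum[OF lin] linear_cmul[OF lin])
    also have "norm \<dots> \<le> (\<Sum>b\<in>(Basis :: 'a set). norm h * B)"
    proof (rule sum_norm_le)
      fix b :: 'a assume "b \<in> Basis"
      then show "norm ((h \<bullet> b) *\<^sub>R f' z b) \<le> norm h * B"
        using Basis_le_norm[of b h] B by (auto intro!: mult_mono)
    qed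
    finally show "norm (f' z h) \<le> DIM('a) * B * norm h" by (simp add: mult_ac)
  qed
qed (use f in auto)

section \<open>Functions on the torus and their lifts\<close>

lemma torus_shift_proj: "torus_shift (torus_proj x) v = torus_proj (x + v)"
  by (rule torus_shift.abs_eq)

lemma torus_pderiv_eq_frechet_derivative:
  assumes "(\<lambda>y. F (torus_proj y)) differentiable (at x)"
  shows "torus_pderiv j F (torus_proj x)
    = frechet_derivative (\<lambda>y. F (torus_proj y)) (at x) (axis j 1)"
proof -
  let ?D = "frechet_derivative (\<lambda>y. F (torus_proj y)) (at x)"
  have D: "((\<lambda>y. F (torus_proj y)) has_derivative ?D) (at (x + 0 *\<^sub>R axis j 1))"
    using assms by (simp add: frechet_derivative_works)
  have "((\<lambda>s. F (torus_proj (x + s *\<^sub>R axis j 1))) has_derivative (\<lambda>s. ?D (s *\<^sub>R axis j 1))) (at 0)"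
    by (rule has_derivative_compose[where f = "\<lambda>s. x + s *\<^sub>R axis j 1" and g = "\<lambda>y. F (torus_proj y)"
        and x = 0 and s = UNIV and f' = "\<lambda>s. s *\<^sub>R axis j 1", OF _ D])
      (auto intro!: derivative_eq_intros)
  moreover have "?D (s *\<^sub>R axis j 1) = s *\<^sub>R ?D (axis j 1)" for s
    using has_derivative_linear[OF D] linear_cmul by blast
  ultimately have "((\<lambda>s. F (torus_proj (x + s *\<^sub>R axis j 1))) has_vector_derivative ?D (axis j 1)) (at 0)"
    by (simp add: has_vector_derivative_def)
  then show ?thesis
    unfolding torus_pderiv_def torus_shift_proj by (rule vector_derivative_at)
qed

definition lift_gradient :: "('d::finite torus \<Rightarrow> real) \<Rightarrow> real ^ 'd \<Rightarrow> real ^ 'd" where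
  "lift_gradient V x = (\<chi> j. torus_pderiv j V (torus_proj x))"

lemma C2_norm_finite_imp_bounded:
  fixes V :: "'d::finite torus \<Rightarrow> real"
  assumes "C2_norm V < \<infinity>"
  shows "\<exists>M. \<forall>i j p. \<bar>torus_pderiv i (torus_pderiv j V) p\<bar> \<le> M"
proof -
  define S where "S i j = (SUP p. ennreal \<bar>torus_pderiv i (torus_pderiv j V) p\<bar>)" for i j
  have S: "S i j < \<infinity>" for i j
  proof -
    have "S i j \<le> (\<Sum>j\<in>UNIV. S i j)" by (rule member_le_sum) auto
    also have "\<dots> \<le> (\<Sum>i\<in>UNIV. \<Sum>j\<in>UNIV. S i j)"
      by (rule member_le_sum[of i UNIV "\<lambda>i. \<Sum>j\<in>UNIV. S i j"]) auto
    also have "\<dots> < \<infinity>"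
      using assms by (simp add: C2_norm_def S_def less_top[symmetric])
    finally show ?thesis .
  qed
  have le: "\<bar>torus_pderiv i (torus_pderiv j V) p\<bar> \<le> enn2real (S i j)" for i j p
  proof -
    have "ennreal \<bar>torus_pderiv i (torus_pderiv j V) p\<bar> \<le> S i j"
      unfolding S_def by (rule SUP_upper) simp
    then have "enn2real (ennreal \<bar>torus_pderiv i (torus_pderiv j V) p\<bar>) \<le> enn2real (S i j)"
      using S by (intro enn2real_mono) auto
    then show ?thesis by simp
  qed
  have "\<bar>torus_pderiv i (torus_pderiv j V) p\<bar> \<le> (\<Sum>i\<in>UNIV. \<Sum>j\<in>UNIV. enn2real (S i j))" for i j p
  proof -
    have "enn2real (S i j) \<le> (\<Sum>j\<in>UNIV. enn2real (S i j))" by (rule member_le_sum) auto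
    also have "\<dots> \<le> (\<Sum>i\<in>UNIV. \<Sum>j\<in>UNIV. enn2real (S i j))"
      by (rule member_le_sum[of i UNIV "\<lambda>i. \<Sum>j\<in>UNIV. enn2real (S i j)"]) (auto intro: sum_nonneg)
    finally show ?thesis using le order_trans by blast
  qed
  then show ?thesis by blast
qed

lemma Basis_axis: "b \<in> (Basis :: (real ^ 'd::finite) set) \<longleftrightarrow> (\<exists>i. b = axis i 1)"
  by (auto simp: Basis_vec_def)

lemma
  fixes V :: "'d::finite torus \<Rightarrow> real"
  assumes "torus_smooth V"
  shows lift_gradient_derivative:
      "((\<lambda>x. V (torus_proj x)) has_derivative (\<lambda>h. lift_gradient V x \<bullet> h)) (at x)"
    and Ck_on_torus_pderiv: "Ck_on k UNIV (\<lambda>x. torus_pderiv j V (torus_proj x))"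
    and Ck_on_lift_gradient: "Ck_on k UNIV (lift_gradient V)"
proof -
  define U where "U x = V (torus_proj x)" for x
  have U: "Ck_on k UNIV U" for k
    using assms by (simp add: torus_smooth_def smooth_on_def U_def[abs_def])
  note D = Ck_on_UNIV_SucD[OF U]
  have pd: "torus_pderiv j V (torus_proj x) = frechet_derivative U (at x) (axis j 1)" for j x
    using D(1)[of x] torus_pderiv_eq_frechet_derivative[of V x j]
    by (auto simp: U_def[abs_def] differentiable_def)
  show C: "Ck_on k UNIV (\<lambda>x. torus_pderiv j V (torus_proj x))" for j
    unfolding pd by (rule D(2)) (auto simp: Basis_axis)
  have "lift_gradient V = (\<lambda>x. \<Sum>j\<in>UNIV. torus_pderiv j V (torus_proj x) *\<^sub>R axis j 1)"
    by (simp add: fun_eq_iff vec_eq_iff lift_gradient_def axis_def if_distrib cong: if_cong)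
  then show "Ck_on k UNIV (lift_gradient V)"
    by (simp only:) (intro Ck_on_sum Ck_on_linear[OF bounded_linear_scaleR_left] C)
  have "frechet_derivative U (at x) = (\<lambda>h. lift_gradient V x \<bullet> h)"
  proof
    fix h
    have lin: "linear (frechet_derivative U (at x))"
      using D(1) has_derivative_linear by blast
    have "frechet_derivative U (at x) h = frechet_derivative U (at x) (\<Sum>j\<in>UNIV. (h $ j) *\<^sub>R axis j 1)"
      using basis_expansion[of h] by (simp add: scalar_mult_eq_scaleR)
    also have "\<dots> = (\<Sum>j\<in>UNIV. h $ j * frechet_derivative U (at x) (axis j 1))"
      by (simp add: linear_sum[OF lin] linear_cmul[OF lin])
    also have "\<dots> = lift_gradient V x \<bullet> h"
      by (simp add: lift_gradient_def inner_vec_def pd mult.commute)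
    finally show "frechet_derivative U (at x) h = lift_gradient V x \<bullet> h" .
  qed
  then show "((\<lambda>x. V (torus_proj x)) has_derivative (\<lambda>h. lift_gradient V x \<bullet> h)) (at x)"
    using D(1)[of x] by (simp add: U_def[abs_def])
qed

lemma lift_gradient_lipschitz:
  fixes V :: "'d::finite torus \<Rightarrow> real"
  assumes "torus_smooth V" "C2_norm V < \<infinity>"
  shows "\<exists>B. \<forall>x y. norm (lift_gradient V x - lift_gradient V y) \<le> B * norm (x - y)"
proof -
  obtain M where M: "\<And>i j p. \<bar>torus_pderiv i (torus_pderiv j V) p\<bar> \<le> M"
    using C2_norm_finite_imp_bounded[OF assms(2)] by blast
  have comp: "norm (torus_pderiv j V (torus_proj x) - torus_pderiv j V (torus_proj y))
      \<le> (DIM(real ^ 'd) * M) * norm (x - y)" for j x y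
  proof (rule lipschitz_if_partial_derivatives_bounded)
    note D = Ck_on_UNIV_SucD(1)[OF Ck_on_torus_pderiv[OF assms(1)], of j]
    show "((\<lambda>x. torus_pderiv j V (torus_proj x)) has_derivative
        frechet_derivative (\<lambda>x. torus_pderiv j V (torus_proj x)) (at x)) (at x)" for x by (rule D)
    show "norm (frechet_derivative (\<lambda>x. torus_pderiv j V (torus_proj x)) (at x) b) \<le> M"
      if "b \<in> Basis" for x b
    proof -
      obtain i where "b = axis i 1" using \<open>b \<in> Basis\<close> by (auto simp: Basis_axis)
      then show ?thesis
        using M[of i j "torus_proj x"] torus_pderiv_eq_frechet_derivative[of "torus_pderiv j V" x i]
          differentiableI[OF D] by simp
    qed
  qed
  show ?thesis
  proof (intro exI allI)
    fix x y :: "real ^ 'd"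
    have "norm (lift_gradient V x - lift_gradient V y)
        \<le> (\<Sum>j\<in>UNIV. \<bar>(lift_gradient V x - lift_gradient V y) $ j\<bar>)" by (rule norm_le_l1_cart)
    also have "\<dots> \<le> (\<Sum>j\<in>(UNIV :: 'd set). (DIM(real ^ 'd) * M) * norm (x - y))"
      using comp by (intro sum_mono) (simp add: lift_gradient_def)
    finally show "norm (lift_gradient V x - lift_gradient V y)
        \<le> (real CARD('d) * (DIM(real ^ 'd) * M)) * norm (x - y)" by simp
  qed
qed

section \<open>Solutions of prescribed winding number\<close>

text \<open>The increment over a unit period of a lift that depends on the first coordinate only; it is a
  homotopy invariant of the map.\<close>

definition winds :: "'d \<Rightarrow> nat \<Rightarrow> (3 torus \<Rightarrow> 'd::finite torus) \<Rightarrow> bool" where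
  "winds i \<kappa> q \<longleftrightarrow> (\<exists>\<psi>. continuous_on UNIV \<psi> \<and>
     (\<forall>x. q (torus_proj x) = torus_proj (\<psi> (x $ 1))) \<and> \<psi> 1 - \<psi> 0 = real \<kappa> *\<^sub>R axis i 1)"

text \<open>Two lifts of the same map differ by a continuous integer-valued function, which is constant, so
  they have the same increment over a period.\<close>

lemma winds_unique:
  assumes "winds i \<kappa> q" "winds i \<mu> q"
  shows "\<kappa> = \<mu>"
proof -
  obtain \<psi> \<eta> where c: "continuous_on UNIV \<psi>" "continuous_on UNIV \<eta>"
    and q: "\<And>x. q (torus_proj x) = torus_proj (\<psi> (x $ 1))"
      "\<And>x. q (torus_proj x) = torus_proj (\<eta> (x $ 1))"
    and incr: "\<psi> 1 - \<psi> 0 = real \<kappa> *\<^sub>R axis i 1" "\<eta> 1 - \<eta> 0 = real \<mu> *\<^sub>R axis i 1"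
    using assms unfolding winds_def by metis
  define h where "h s = \<psi> s $ i - \<eta> s $ i" for s
  have int: "h s \<in> \<int>" for s
  proof -
    have "torus_proj (\<psi> s) = torus_proj (\<eta> s)"
      using q(1)[of "\<chi> j. s"] q(2)[of "\<chi> j. s"] by simp
    then show ?thesis by (simp add: torus_proj_eq_iff h_def)
  qed
  have "h constant_on UNIV"
  proof (rule continuous_discrete_range_constant)
    show "continuous_on UNIV h" unfolding h_def by (intro continuous_intros c)
    show "\<exists>e>0. \<forall>y. y \<in> UNIV \<and> h y \<noteq> h x \<longrightarrow> e \<le> norm (h y - h x)" for x
      using Ints_nonzero_abs_ge1[OF Ints_diff[OF int int]] by (intro exI[of _ 1]) auto
  qed simp
  then have "h 1 = h 0" unfolding constant_on_def by auto
  moreover have "\<psi> 1 $ i - \<psi> 0 $ i = \<kappa>" "\<eta> 1 $ i - \<eta> 0 $ i = \<mu>"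
    using arg_cong[OF incr(1), of "\<lambda>x. x $ i"] arg_cong[OF incr(2), of "\<lambda>x. x $ i"]
    by (simp_all add: axis_def)
  ultimately show ?thesis by (simp add: h_def)
qed

text \<open>The factor \<open>\<kappa>\<^sup>2\<close> produced by differentiating \<open>\<phi> (\<kappa> t\<^sub>1)\<close> twice cancels the small factor in
  front of the force. The map is well defined on the torus since \<open>\<kappa>\<close> is an integer.\<close>

lemma winding_orbit_gives_solution:
  fixes V :: "'d::finite torus \<Rightarrow> real" and \<kappa> :: nat
  assumes V: "torus_smooth V" and "\<kappa> > 0"
    and \<phi>: "\<And>s. (\<phi> has_vector_derivative v s) (at s)"
    and v: "\<And>s. (v has_vector_derivative - ((1 / (real \<kappa>)\<^sup>2) *\<^sub>R lift_gradient V (\<phi> s))) (at s)"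
    and per: "\<And>s. \<phi> (s + 1) = \<phi> s + axis i 1"
  shows "\<exists>q. laplace_solution V q \<and> winds i \<kappa> q"
proof -
  define q where "q p = torus_proj (\<phi> (real \<kappa> * (rep_torus p $ 1)))" for p :: "3 torus"
  have shift: "\<phi> (s + real n) = \<phi> s + real n *\<^sub>R axis i 1" for s n
  proof (induction n)
    case (Suc n)
    have "\<phi> (s + real (Suc n)) = \<phi> (s + real n + 1)" by (simp add: add_ac)
    also have "\<dots> = \<phi> s + real n *\<^sub>R axis i 1 + axis i 1" by (simp only: per Suc)
    finally show ?case by (simp add: scaleR_add_left add_ac)
  qed simp
  have shift_int: "torus_proj (\<phi> (s + of_int n)) = torus_proj (\<phi> s)" for s n
  proof (cases "n \<ge> 0")
    case True
    then show ?thesis using shift[of s "nat n"] by (simp add: torus_proj_eq_iff axis_def)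
  next
    case False
    then show ?thesis using shift[of "s + of_int n" "nat (- n)"] by (simp add: torus_proj_eq_iff axis_def)
  qed
  have q: "q (torus_proj x) = torus_proj (\<phi> (real \<kappa> * (x $ 1)))" for x
  proof -
    have "torus_proj (rep_torus (torus_proj x)) = torus_proj x"
      by (rule Quotient_abs_rep[OF Quotient_torus])
    then obtain n where n: "rep_torus (torus_proj x) $ 1 = x $ 1 + of_int n"
      unfolding torus_proj_eq_iff Ints_def
      by (metis (no_types, lifting) add.commute diff_add_cancel imageE vector_minus_component)
    show ?thesis
      unfolding q_def n using shift_int[of "real \<kappa> * (x $ 1)" "int \<kappa> * n"] by (simp add: algebra_simps)
  qed
  have "Ck_on k UNIV \<phi>" for k
  proof -
    have "Ck_on k UNIV (\<lambda>y. - ((1 / (real \<kappa>)\<^sup>2) *\<^sub>R lift_gradient V y))" for k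
      by (intro Ck_on_linear[OF bounded_linear_compose[OF bounded_linear_minus[OF bounded_linear_ident]
            bounded_linear_scaleR_right]] Ck_on_lift_gradient V)
    then show ?thesis using Ck_on_second_order_ode[OF \<phi> v] by blast
  qed
  moreover have "Ck_on k UNIV (\<lambda>x :: real ^ 3. real \<kappa> * (x $ 1))" for k
    by (intro Ck_on_bounded_linear bounded_linear_const_mult bounded_linear_vec_nth)
  ultimately have "smooth_on UNIV (\<lambda>x :: real ^ 3. \<phi> (real \<kappa> * (x $ 1)))"
    unfolding smooth_on_def by (intro allI) (rule Ck_on_compose[where F = \<phi>])
  then have smooth: "torus_smooth_map q"
    unfolding torus_smooth_map_def using q
    by (intro allI exI[of _ UNIV] exI[of _ "\<lambda>x. \<phi> (real \<kappa> * (x $ 1))"]) auto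
  have chain: "((\<lambda>s. f (real \<kappa> * ((x + s *\<^sub>R axis j 1) $ 1))) has_vector_derivative
      (if j = 1 then real \<kappa> *\<^sub>R f' (real \<kappa> * (x $ 1)) else 0)) (at 0)"
    if "\<And>s. (f has_vector_derivative f' s) (at s)" for f f' and j :: 3 and x :: "real ^ 3"
  proof (cases "j = 1")
    case True
    have "((f \<circ> (\<lambda>s. real \<kappa> * (x $ 1 + s))) has_vector_derivative
        real \<kappa> *\<^sub>R f' (real \<kappa> * (x $ 1 + 0))) (at 0)"
      by (rule vector_diff_chain_at[OF _ that]) (auto intro!: derivative_eq_intros)
    then show ?thesis using True by (simp add: o_def axis_def)
  next
    case False
    then show ?thesis by (simp add: axis_def)
  qed
  have first: "torus_map_pderiv j q (torus_proj x)
      = (if j = 1 then real \<kappa> *\<^sub>R v (real \<kappa> * (x $ 1)) else 0)" for j x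
  proof -
    have D: "has_torus_derivative (\<lambda>s. q (torus_shift (torus_proj x) (s *\<^sub>R axis j 1)))
        (if j = 1 then real \<kappa> *\<^sub>R v (real \<kappa> * (x $ 1)) else 0) 0"
      unfolding has_torus_derivative_def torus_shift_proj q
      by (intro exI[of _ "\<lambda>s. \<phi> (real \<kappa> * ((x + s *\<^sub>R axis j 1) $ 1))"] conjI chain[OF \<phi>]
          always_eventually allI refl)
    show ?thesis
      unfolding torus_map_pderiv_def
      by (rule the_equality, rule D, erule has_torus_derivative_unique[OF _ D])
  qed
  have second: "torus_pderiv j (torus_map_pderiv j q) (torus_proj x)
      = (if j = 1 then - lift_gradient V (\<phi> (real \<kappa> * (x $ 1))) else 0)" for j x
  proof (cases "j = 1")
    case True
    have "((\<lambda>s. real \<kappa> *\<^sub>R v (real \<kappa> * ((x + s *\<^sub>R axis j 1) $ 1))) has_vector_derivative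
       real \<kappa> *\<^sub>R (real \<kappa> *\<^sub>R - ((1 / (real \<kappa>)\<^sup>2) *\<^sub>R lift_gradient V (\<phi> (real \<kappa> * (x $ 1)))))) (at 0)"
      using bounded_linear.has_vector_derivative[OF bounded_linear_scaleR_right chain[OF v, of x j]] True
      by simp
    then show ?thesis
      unfolding torus_pderiv_def torus_shift_proj first using True \<open>\<kappa> > 0\<close>
      by (simp add: vector_derivative_at power2_eq_square)
  next
    case False
    then show ?thesis unfolding torus_pderiv_def torus_shift_proj first by simp
  qed
  have "laplace_solution V q"
    unfolding laplace_solution_def
  proof (intro conjI allI smooth)
    fix t :: "3 torus" and \<alpha>
    obtain x where t: "t = torus_proj x"
      using Quotient_abs_rep[OF Quotient_torus] by metis
    show "- (torus_map_laplacian q t $ \<alpha>) = torus_pderiv \<alpha> V (q t)"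
      by (simp add: torus_map_laplacian_def t second q lift_gradient_def)
  qed
  moreover have "winds i \<kappa> q"
    unfolding winds_def
  proof (intro exI conjI allI)
    have "continuous_on UNIV \<phi>"
      using has_vector_derivative_continuous[OF \<phi>] by (simp add: continuous_at_imp_continuous_on)
    then show "continuous_on UNIV (\<lambda>s. \<phi> (real \<kappa> * s))"
      by (rule continuous_on_compose2) (auto intro: continuous_intros)
    show "\<phi> (real \<kappa> * 1) - \<phi> (real \<kappa> * 0) = real \<kappa> *\<^sub>R axis i 1"
      using shift[of 0 \<kappa>] by simp
  qed (rule q)
  ultimately show ?thesis by blast
qed

text \<open>After scaling by \<open>\<kappa>\<^sup>-\<^sup>2\<close> the force has Lipschitz constant \<open>B / \<kappa>\<^sup>2 \<le> B / \<kappa> \<le> 1 / 8\<close>.\<close>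

lemma solution_of_large_winding_exists:
  fixes V :: "'d::finite torus \<Rightarrow> real"
  assumes V: "torus_smooth V"
    and lip: "\<And>x y. norm (lift_gradient V x - lift_gradient V y) \<le> B * norm (x - y)"
    and "\<kappa> > 0" and large: "8 * B \<le> real \<kappa>"
  shows "\<exists>q. laplace_solution V q \<and> winds i \<kappa> q"
proof -
  define \<epsilon> where "\<epsilon> = 1 / (real \<kappa>)\<^sup>2"
  have \<epsilon>: "\<epsilon> > 0" using \<open>\<kappa> > 0\<close> by (simp add: \<epsilon>_def)
  have per: "V (torus_proj (x + z)) = V (torus_proj x)" if "\<And>i. z $ i \<in> \<int>" for x z
  proof -
    have "torus_proj (x + z) = torus_proj x" using that by (simp add: torus_proj_eq_iff)
    then show ?thesis by simp
  qed
  interpret weak_periodic_force "\<lambda>x. \<epsilon> * V (torus_proj x)" "\<lambda>x. \<epsilon> *\<^sub>R lift_gradient V x" "\<epsilon> * B" "axis i 1"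
  proof
    show "((\<lambda>x. \<epsilon> * V (torus_proj x)) has_derivative (\<lambda>h. (\<epsilon> *\<^sub>R lift_gradient V x) \<bullet> h)) (at x)" for x
      using has_derivative_mult_right[OF lift_gradient_derivative[OF V], of \<epsilon>] by simp
    show "norm (\<epsilon> *\<^sub>R lift_gradient V x - \<epsilon> *\<^sub>R lift_gradient V y) \<le> \<epsilon> * B * norm (x - y)" for x y
      using \<epsilon> lip[of x y] by (simp add: scaleR_diff_right[symmetric] mult.assoc)
    have "real \<kappa> * 1 \<le> real \<kappa> * real \<kappa>" using \<open>\<kappa> > 0\<close> by (intro mult_left_mono) auto
    then have "8 * B \<le> (real \<kappa>)\<^sup>2" using large by (simp add: power2_eq_square)
    then show "\<epsilon> * B \<le> 1 / 8" using \<open>\<kappa> > 0\<close> by (simp add: \<epsilon>_def field_simps)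
    show "\<epsilon> * V (torus_proj (x + axis i 1)) = \<epsilon> * V (torus_proj x)" for x
      by (subst per) (auto simp: axis_def)
  qed
  have "\<exists>\<phi> v. (\<forall>s. (\<phi> has_vector_derivative v s) (at s)) \<and>
     (\<forall>s. (v has_vector_derivative - (\<epsilon> *\<^sub>R lift_gradient V (\<phi> s))) (at s)) \<and>
     (\<forall>s. \<phi> (s + 1) = \<phi> s + axis i 1)"
  proof (rule winding_orbit_exists)
    show "compact (cbox 0 (\<chi> j. 1) :: (real ^ 'd) set)" by (rule compact_cbox)
    have "0 \<in> (cbox 0 (\<chi> j. 1) :: (real ^ 'd) set)" by (simp add: mem_box_cart)
    then show "cbox 0 (\<chi> j. 1) \<noteq> ({} :: (real ^ 'd) set)" by blast
    fix x :: "real ^ 'd"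
    define z :: "real ^ 'd" where "z = (\<chi> j. - of_int \<lfloor>x $ j\<rfloor>)"
    have "x + z \<in> cbox 0 (\<chi> j. 1)"
      unfolding mem_box_cart z_def by simp linarith
    moreover have "\<epsilon> * V (torus_proj (y + z)) = \<epsilon> * V (torus_proj y)" for y
      by (subst per) (auto simp: z_def)
    ultimately show "\<exists>z. x + z \<in> cbox 0 (\<chi> j. 1) \<and>
        (\<forall>y. \<epsilon> * V (torus_proj (y + z)) = \<epsilon> * V (torus_proj y))" by blast
  qed
  then obtain \<phi> v where "\<And>s. (\<phi> has_vector_derivative v s) (at s)"
    and "\<And>s. (v has_vector_derivative - (\<epsilon> *\<^sub>R lift_gradient V (\<phi> s))) (at s)"
    and "\<And>s. \<phi> (s + 1) = \<phi> s + axis i 1" by blast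
  then show ?thesis
    using V \<open>\<kappa> > 0\<close> by (intro winding_orbit_gives_solution[where \<phi> = \<phi> and v = v]) (auto simp: \<epsilon>_def)
qed

theorem corollary2p4:
  fixes V :: "'d::finite torus \<Rightarrow> real"
  assumes "torus_smooth V"
    and "C2_norm V < \<infinity>"
  shows "\<exists>S :: (3 torus \<Rightarrow> 'd torus) set.
           (\<forall>q\<in>S. laplace_solution V q) \<and> finite S \<and> card S = CARD('d) + 1"
proof -
  obtain B where B: "\<forall>x y. norm (lift_gradient V x - lift_gradient V y) \<le> B * norm (x - y)"
    using lift_gradient_lipschitz[OF assms] ..
  obtain K :: nat where K: "8 * B \<le> real K" using real_arch_simple by blast
  fix i :: 'd
  have "\<exists>q. laplace_solution V q \<and> winds i (K + 1 + n) q" for n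
    using K by (intro solution_of_large_winding_exists[OF assms(1) B[rule_format]]) auto
  then obtain q where q: "\<And>n. laplace_solution V (q n)" "\<And>n. winds i (K + 1 + n) (q n)" by metis
  have "inj q"
  proof (rule injI)
    fix m n assume "q m = q n"
    then have "K + 1 + m = K + 1 + n" using q(2)[of m] q(2)[of n] winds_unique by metis
    then show "m = n" by simp
  qed
  then have "card (q ` {..<CARD('d) + 1}) = CARD('d) + 1"
    by (simp add: card_image inj_on_subset)
  then show ?thesis
    using q(1) by (intro exI[of _ "q ` {..<CARD('d) + 1}"]) auto
qed

end
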